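(* Let $a,b,c,\mu\in\mathbb{C}$ be arbitrary. In each of the eight cases (1)–(8) listed in the context, with the data $(a',b',c')$, $x_0$, $K(x,y)$, $R(x,y)$, $J$ given there, for all $x\in J$ and all $y$ in the open interval with endpoints $x_0$ and $x$: $$L_{a',b',c';x}\Big(K(x,y)\,|x-y|^{\mu-1}\Big)=L_{1-a,1-b,2-c;y}\Big(K(x,y)\,R(x,y)\,|x-y|^{\mu-1}\Big).$$
   Context: For complex $a,b,c$ the hypergeometric differential operator in a real variable $z$ is $$L_{a,b,c;z}(f(z)):=z(1-z)f''(z)+(c-(a+b+1)z)f'(z)-ab\,f(z).$$ The operator with subscript $x$ acts on the variable $x$ (with $y$ fixed), the one with subscript $y$ acts on $y$ (with $x$ fixed). The eight cases: (1) $(a',b',c')=(a,b,c+\mu)$, $x_0=0$, $K=\dfrac{|y|^{c-1}}{|x|^{c+\mu-1}}$, $R=1$, $J=(-\infty,0)\cup(0,1)$. (2) $(a',b',c')=(a+\mu,b,c+\mu)$, $x_0=0$, $K=\dfrac{|y|^{c-1}(1-y)^{b-c-\mu}}{|x|^{c+\mu-1}(1-x)^{b-c}}$, $R=\dfrac{1-y}{1-x}$, $J=(-\infty,0)\cup(0,1)$. (3) $(a',b',c')=(a+\mu,b+\mu,c+\mu)$, $x_0=0$, $K=\dfrac{|y|^{c-1}(1-y)^{a+b-c}}{|x|^{c+\mu-1}(1-x)^{a+b-c+\mu}}$, $R=1$, $J=(-\infty,0)\cup(0,1)$. (4) $(a',b',c')=(a-\mu,b,c)$, $x_0=0$, $K=\dfrac{|y|^{a-\mu-1}}{|x|^{a-1}}$,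 $R=\dfrac{|y|}{|x|}$, $J=(-\infty,0)\cup(0,1)$. (5) $(a',b',c')=(a+\mu,b,c)$, $x_0=0$, $K=\dfrac{|y|^{c-a-\mu-1}(1-y)^{a+b-c}}{|x|^{c-a-1}(1-x)^{a+b-c+\mu}}$, $R=\dfrac{|y|}{|x|}$, $J=(-\infty,0)\cup(0,1)$. (6) $(a',b',c')=(a-\mu,b-\mu,c-\mu)$, $x_0=-\infty$, $K=1$, $R=1$, $J=(-\infty,1)$. (7) $(a',b',c')=(a-\mu,b,c-\mu)$, $x_0=1$, $K=\dfrac{(1-y)^{a-\mu-1}}{(1-x)^{a-1}}$, $R=\dfrac{1-y}{1-x}$, $J=(-\infty,1)$. (8) $(a',b',c')=(a,b,c-\mu)$, $x_0=-\infty$, $K=\dfrac{(1-y)^{a+b-c}}{(1-x)^{a+b-c+\mu}}$, $R=1$, $J=(-\infty,1)$. *)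

theory Defs
  imports "HOL-Analysis.Analysis"
begin

definition hypergeo_op ::
    "complex \<Rightarrow> complex \<Rightarrow> complex \<Rightarrow> (real \<Rightarrow> complex) \<Rightarrow> real \<Rightarrow> complex" where
  "hypergeo_op a b c f z =
     of_real (z * (1 - z)) * vector_derivative (\<lambda>t. vector_derivative f (at t)) (at z)
     + (c - (a + b + 1) * of_real z) * vector_derivative f (at z)
     - a * b * f z"

definition ivl_between :: "ereal \<Rightarrow> real \<Rightarrow> real set" where
  "ivl_between x0 x = {y. min x0 (ereal x) < ereal y \<and> ereal y < max x0 (ereal x)}"

text \<open>
  Complex powers of a real base are written \<open>of_real t powr w\<close>; every base that occurs below is
  positive at the points (and in a neighbourhood of the points) where the identity is evaluated,
  so this is the usual \<open>exp (w * ln t)\<close> and the kernels are smooth there in each variable.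
\<close>

definition kernel_identity ::
    "complex \<Rightarrow> complex \<Rightarrow> complex \<Rightarrow> complex \<Rightarrow> complex \<times> complex \<times> complex \<Rightarrow> ereal \<Rightarrow>
     (real \<Rightarrow> real \<Rightarrow> complex) \<Rightarrow> (real \<Rightarrow> real \<Rightarrow> real) \<Rightarrow> real set \<Rightarrow> bool" where
  "kernel_identity a b c \<mu> abc' x0 K R J \<longleftrightarrow>
     (case abc' of (a', b', c') \<Rightarrow>
       \<forall>x\<in>J. \<forall>y\<in>ivl_between x0 x.
         hypergeo_op a' b' c' (\<lambda>x. K x y * of_real \<bar>x - y\<bar> powr (\<mu> - 1)) x =
         hypergeo_op (1 - a) (1 - b) (2 - c)
           (\<lambda>y. K x y * of_real (R x y) * of_real \<bar>x - y\<bar> powr (\<mu> - 1)) y)"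

end

theory Submission
  imports Defs
begin

text \<open>
  As a function of \<open>x\<close> alone or of \<open>y\<close> alone, each kernel is a product of powers
  \<open>C \<bar>z\<bar>\<^sup>p (1 - z)\<^sup>q \<bar>z - w\<bar>\<^sup>m\<close>. Its logarithmic derivative is the rational function
  \<open>p / z - q / (1 - z) + m / (z - w)\<close>, irrespective of the signs of \<open>z\<close> and \<open>z - w\<close>, so the
  hypergeometric operator multiplies it by a rational function of \<open>z\<close> and \<open>w\<close>. Both sides of the
  claim are thus rational multiples of the same kernel, and comparing the multipliers is a
  polynomial identity in \<open>a, b, c, \<mu>, x, y\<close>.
\<close>

section \<open>Logarithms and their derivatives on both sides of a singular point\<close>

lemma of_real_powr_eq_exp_ln:
  assumes "t > 0"
  shows "complex_of_real t powr p = exp (p * complex_of_real (ln t))"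
  using assms by (simp add: powr_def Ln_of_real)

text \<open>
  If \<open>p = 0\<close>, the point \<open>t = w\<close> is allowed: this is needed for the last three kernels, which have
  no factor \<open>\<bar>x\<bar>\<close> or \<open>\<bar>y\<bar>\<close> but whose range includes \<open>0\<close>.
\<close>

lemma has_vector_derivative_mult_ln_abs:
  fixes p :: complex
  assumes "t \<noteq> w \<or> p = 0"
  shows "((\<lambda>t. p * complex_of_real (ln \<bar>t - w\<bar>)) has_vector_derivative
    p / (of_real t - of_real w)) (at t)"
proof (cases "p = 0")
  case False
  \<comment> \<open>Squaring removes the absolute value, so a single differentiation covers both
    signs of \<open>t - w\<close>. At \<open>u = 0\<close> both sides are 0, since
    \<open>ln 0 = 0\<close>.\<close>
  have eq: "ln \<bar>u\<bar> = ln (u\<^sup>2) / 2" for u :: real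
    using ln_realpow[of "\<bar>u\<bar>" 2] by (cases "u = 0") auto
  from False assms have t: "t - w \<noteq> 0" by simp
  then have "(t - w)\<^sup>2 > 0" by simp
  then have "((\<lambda>t. ln \<bar>t - w\<bar>) has_real_derivative 2 * (t - w) / (t - w)\<^sup>2 / 2) (at t)"
    unfolding eq by (auto intro!: derivative_eq_intros simp: divide_simps)
  also have "2 * (t - w) / (t - w)\<^sup>2 / 2 = 1 / (t - w)"
    using t by (simp add: power2_eq_square divide_simps)
  finally have "((\<lambda>t. ln \<bar>t - w\<bar>) has_real_derivative 1 / (t - w)) (at t)" .
  from has_vector_derivative_mult_right[OF has_vector_derivative_of_real[OF this], of p]
  show ?thesis by simp
qed simp

section \<open>Action of the hypergeometric operator on a product of powers\<close>

text \<open>This is the multiplier \<open>L f / f\<close>: with \<open>l = f' / f\<close>, the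
  factor after \<open>z * (1 - z)\<close> is \<open>f'' / f = l\<^sup>2 + l'\<close>.\<close>

definition hypergeo_symbol ::
  "complex \<Rightarrow> complex \<Rightarrow> complex \<Rightarrow> complex \<Rightarrow> complex \<Rightarrow> complex \<Rightarrow> complex \<Rightarrow> complex \<Rightarrow> complex" where
  "hypergeo_symbol a b c p q m w z =
     (let l = p / z - q / (1 - z) + m / (z - w) in
       z * (1 - z) * (l\<^sup>2 - p / z\<^sup>2 - q / (1 - z)\<^sup>2 - m / (z - w)\<^sup>2)
       + (c - (a + b + 1) * z) * l - a * b)"

text \<open>From \<open>f' = l * f\<close> on an open set it follows that
  \<open>f'' = (l' + l\<^sup>2) * f\<close>. The product form is required only on a neighbourhood
  \<open>S\<close> of \<open>z\<close>, and \<open>k\<close> absorbs every factor that does not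
  depend on \<open>z\<close>.\<close>

lemma hypergeo_op_power_product:
  fixes f :: "real \<Rightarrow> complex"
  assumes S: "open S" "z \<in> S" "S \<subseteq> {..<1} - {w}" "0 \<notin> S \<or> p = 0"
    and f: "\<And>t. t \<in> S \<Longrightarrow>
      f t = exp (k + p * of_real (ln \<bar>t\<bar>) + q * of_real (ln (1 - t)) + m * of_real (ln \<bar>t - w\<bar>))"
  shows "hypergeo_op a b c f z = hypergeo_symbol a b c p q m (of_real w) (of_real z) * f z"
proof -
  define \<phi> where "\<phi> t =
    k + p * of_real (ln \<bar>t\<bar>) + q * of_real (ln (1 - t)) + m * of_real (ln \<bar>t - w\<bar>)" for t
  define l :: "real \<Rightarrow> complex" where
    "l t = p / of_real t - q / (1 - of_real t) + m / (of_real t - of_real w)" for t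
  define D where "D = - p / (of_real z)\<^sup>2 - q / (1 - of_real z)\<^sup>2 - m / (of_real z - of_real w)\<^sup>2"
  have S_D: "t < 1" "t \<noteq> w" "t \<noteq> 0 \<or> p = 0" if "t \<in> S" for t
    using S that by auto
  have \<phi>': "(\<phi> has_vector_derivative l t) (at t)" if t: "t \<in> S" for t
  proof -
    have ln_0: "((\<lambda>t. p * complex_of_real (ln \<bar>t\<bar>)) has_vector_derivative p / of_real t) (at t)"
      using has_vector_derivative_mult_ln_abs[of t 0 p] S_D[OF t] by simp
    have ln_w: "((\<lambda>t. m * complex_of_real (ln \<bar>t - w\<bar>)) has_vector_derivative
        m / (of_real t - of_real w)) (at t)"
      using has_vector_derivative_mult_ln_abs S_D[OF t] by simp
    have "((\<lambda>t. ln (1 - t)) has_real_derivative - 1 / (1 - t)) (at t)"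
      using S_D[OF t] by (auto intro!: derivative_eq_intros)
    from has_vector_derivative_mult_right[OF has_vector_derivative_of_real[OF this], of q]
    have ln_1: "((\<lambda>t. q * complex_of_real (ln (1 - t))) has_vector_derivative
        - (q / (1 - of_real t))) (at t)"
      by simp
    show ?thesis
      unfolding \<phi>_def l_def
      using has_vector_derivative_add[OF has_vector_derivative_add[OF has_vector_derivative_add[OF
            has_vector_derivative_const[of k] ln_0] ln_1] ln_w]
      by simp
  qed
  \<comment> \<open>The formula is needed on all of \<open>S\<close>, not just at \<open>z\<close>,
    because it is differentiated once more.\<close>
  have f': "(f has_vector_derivative l t * f t) (at t)" if t: "t \<in> S" for t
  proof (rule has_vector_derivative_transform_within_open[OF _ S(1) t])
    show "((\<lambda>t. exp (\<phi> t)) has_vector_derivative l t * f t) (at t)"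
      using field_vector_diff_chain_at[OF \<phi>'[OF t] DERIV_exp] f[OF t] by (simp add: o_def \<phi>_def)
  qed (simp add: f \<phi>_def)
  have l': "(l has_vector_derivative D) (at z)"
  proof -
    have z: "of_real z \<noteq> (1::complex)" "of_real z \<noteq> complex_of_real w" "of_real z \<noteq> (0::complex) \<or> p = 0"
      using S_D[OF S(2)] by auto
    \<comment> \<open>The rational function \<open>l\<close> is differentiated in a complex variable
      and then restricted to the real line. For \<open>p = 0\<close> this term is constantly 0, so
      \<open>z = 0\<close> does no harm.\<close>
    have "((\<lambda>u. p / u) has_field_derivative - p / (of_real z)\<^sup>2) (at (of_real z))"
      using z by (cases "p = 0") (auto intro!: derivative_eq_intros simp: power2_eq_square)
    moreover have "((\<lambda>u. q / (1 - u)) has_field_derivative q / (1 - of_real z)\<^sup>2) (at (of_real z))"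
      using z by (auto intro!: derivative_eq_intros simp: power2_eq_square)
    moreover have "((\<lambda>u. m / (u - of_real w)) has_field_derivative
        - m / (of_real z - of_real w)\<^sup>2) (at (of_real z))"
      using z by (auto intro!: derivative_eq_intros simp: power2_eq_square)
    ultimately have "((\<lambda>u. p / u - q / (1 - u) + m / (u - of_real w)) has_field_derivative
        - p / (of_real z)\<^sup>2 - q / (1 - of_real z)\<^sup>2 + - m / (of_real z - of_real w)\<^sup>2) (at (of_real z))"
      by (intro DERIV_add DERIV_diff)
    from has_vector_derivative_real_field[OF this] show ?thesis
      by (simp add: l_def[abs_def] D_def)
  qed
  have "((\<lambda>t. vector_derivative f (at t)) has_vector_derivative (D + (l z)\<^sup>2) * f z) (at z)"
  proof (rule has_vector_derivative_transform_within_open[OF _ S(1,2)])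
    show "((\<lambda>t. l t * f t) has_vector_derivative (D + (l z)\<^sup>2) * f z) (at z)"
      using has_vector_derivative_mult[OF l' f'[OF S(2)]]
      by (simp add: algebra_simps power2_eq_square)
  qed (simp add: vector_derivative_at[OF f'])
  note second = vector_derivative_at[OF this] and first = vector_derivative_at[OF f'[OF S(2)]]
  have "hypergeo_symbol a b c p q m (of_real w) (of_real z) =
      of_real (z * (1 - z)) * (D + (l z)\<^sup>2) + (c - (a + b + 1) * of_real z) * l z - a * b"
    by (simp add: hypergeo_symbol_def Let_def l_def D_def)
  then show ?thesis
    unfolding hypergeo_op_def first second by (simp add: ring_distribs mult.assoc)
qed

section \<open>Reduction to an identity between multipliers\<close>

text \<open>The factor \<open>R\<close> is written as
  \<open>(\<bar>y\<bar> / \<bar>x\<bar>)^d * ((1 - y) / (1 - x))^e\<close>, so \<open>K * R\<close>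
  has exponents \<open>r + d\<close> and \<open>s + e\<close> in \<open>y\<close>. Once the
  operators have been replaced by multipliers, the kernel is a common factor and only
  \<open>R\<close> is left on the right.\<close>

lemma kernel_identity_of_symbol:
  assumes J: "open J" "J \<subseteq> {..<1}" "0 \<notin> J \<or> p = 0 \<and> r = 0 \<and> d = 0"
    and ivl: "\<And>x y. x \<in> J \<Longrightarrow> y \<in> ivl_between x0 x \<Longrightarrow> y \<in> J \<and> y \<noteq> x"
    and K: "\<And>x y. x \<in> J \<Longrightarrow> y \<in> J \<Longrightarrow> K x y =
      exp (p * of_real (ln \<bar>x\<bar>) + q * of_real (ln (1 - x)) + r * of_real (ln \<bar>y\<bar>) + s * of_real (ln (1 - y)))"
    and R: "\<And>x y. x \<in> J \<Longrightarrow> y \<in> J \<Longrightarrow> complex_of_real (R x y) =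
      exp (d * (of_real (ln \<bar>y\<bar>) - of_real (ln \<bar>x\<bar>)) + e * (of_real (ln (1 - y)) - of_real (ln (1 - x))))"
    and symbol: "\<And>x y. x \<in> J \<Longrightarrow> y \<in> ivl_between x0 x \<Longrightarrow>
      hypergeo_symbol a' b' c' p q (\<mu> - 1) (of_real y) (of_real x) =
      hypergeo_symbol (1 - a) (1 - b) (2 - c) (r + d) (s + e) (\<mu> - 1) (of_real x) (of_real y)
        * of_real (R x y)"
  shows "kernel_identity a b c \<mu> (a', b', c') x0 K R J"
  unfolding kernel_identity_def split
proof (intro ballI)
  fix x y assume x: "x \<in> J" and y_ivl: "y \<in> ivl_between x0 x"
  then have y: "y \<in> J" and "y \<noteq> x" using ivl by auto
  let ?f = "\<lambda>x. K x y * of_real \<bar>x - y\<bar> powr (\<mu> - 1)"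
  let ?g = "\<lambda>y. K x y * of_real (R x y) * of_real \<bar>x - y\<bar> powr (\<mu> - 1)"
  have "hypergeo_op a' b' c' ?f x =
      hypergeo_symbol a' b' c' p q (\<mu> - 1) (of_real y) (of_real x) * ?f x"
  proof (rule hypergeo_op_power_product[where S = "J - {y}"
        and k = "r * of_real (ln \<bar>y\<bar>) + s * of_real (ln (1 - y))"])
    show "?f t = exp (r * of_real (ln \<bar>y\<bar>) + s * of_real (ln (1 - y)) + p * of_real (ln \<bar>t\<bar>)
        + q * of_real (ln (1 - t)) + (\<mu> - 1) * of_real (ln \<bar>t - y\<bar>))" if "t \<in> J - {y}" for t
      using that y by (simp add: K of_real_powr_eq_exp_ln flip: exp_add) (simp add: algebra_simps)
  qed (use J x y \<open>y \<noteq> x\<close> in \<open>auto intro: open_delete\<close>)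
  moreover have "hypergeo_op (1 - a) (1 - b) (2 - c) ?g y =
      hypergeo_symbol (1 - a) (1 - b) (2 - c) (r + d) (s + e) (\<mu> - 1) (of_real x) (of_real y) * ?g y"
  \<comment> \<open>Here \<open>x\<close> is frozen; \<open>R\<close> contributes \<open>-d\<close>
    and \<open>-e\<close> to the exponents of \<open>\<bar>x\<bar>\<close> and \<open>1 - x\<close>,
    which \<open>k\<close> collects.\<close>
  proof (rule hypergeo_op_power_product[where S = "J - {x}"
        and k = "(p - d) * of_real (ln \<bar>x\<bar>) + (q - e) * of_real (ln (1 - x))"])
    show "?g t = exp ((p - d) * of_real (ln \<bar>x\<bar>) + (q - e) * of_real (ln (1 - x))
        + (r + d) * of_real (ln \<bar>t\<bar>) + (s + e) * of_real (ln (1 - t))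
        + (\<mu> - 1) * of_real (ln \<bar>t - x\<bar>))" if "t \<in> J - {x}" for t
      using that x unfolding abs_minus_commute[of t x]
      by (simp add: K R of_real_powr_eq_exp_ln flip: exp_add) (simp add: algebra_simps)
  qed (use J x y \<open>y \<noteq> x\<close> in \<open>auto intro: open_delete\<close>)
  ultimately show "hypergeo_op a' b' c' ?f x = hypergeo_op (1 - a) (1 - b) (2 - c) ?g y"
    using symbol[OF x y_ivl] by simp
qed

section \<open>Clearing denominators in the multipliers\<close>

text \<open>The symbol multiplied by \<open>z * (1 - z) * (z - w)\<^sup>2\<close>. In
  \<open>l\<^sup>2 + l'\<close> the squares combine with \<open>l'\<close> to
  \<open>p * (p - 1)\<close>, \<open>q * (q - 1)\<close>, \<open>m * (m - 1)\<close>, and the other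
  products are the mixed terms.\<close>

definition hypergeo_numerator ::
  "complex \<Rightarrow> complex \<Rightarrow> complex \<Rightarrow> complex \<Rightarrow> complex \<Rightarrow> complex \<Rightarrow> complex \<Rightarrow> complex \<Rightarrow> complex" where
  "hypergeo_numerator a b c p q m w z =
     p * (p - 1) * ((1 - z) * (z - w))\<^sup>2 + q * (q - 1) * (z * (z - w))\<^sup>2
     + m * (m - 1) * (z * (1 - z))\<^sup>2 - 2 * p * q * z * (1 - z) * (z - w)\<^sup>2
     + 2 * p * m * z * (1 - z)\<^sup>2 * (z - w) - 2 * q * m * z\<^sup>2 * (1 - z) * (z - w)
     + (c - (a + b + 1) * z) * (p * (1 - z) * (z - w) - q * z * (z - w) + m * z * (1 - z)) * (z - w)
     - a * b * z * (1 - z) * (z - w)\<^sup>2"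

lemma hypergeo_symbol_eq_numerator:
  assumes "z \<noteq> 0" "z \<noteq> 1" "z \<noteq> w"
  shows "hypergeo_symbol a b c p q m w z =
    hypergeo_numerator a b c p q m w z / (z * (1 - z) * (w - z)\<^sup>2)"
proof -
  \<comment> \<open>The identity already holds with \<open>z\<close>, \<open>u\<close>,
    \<open>v\<close> treated as independent; naming the differences prevents their expansion when
    fractions are cleared.\<close>
  define u where "u = 1 - z"
  define v where "v = z - w"
  have "u \<noteq> 0" "v \<noteq> 0" using assms by (auto simp: u_def v_def)
  then show ?thesis
    using assms(1)
    unfolding hypergeo_symbol_def hypergeo_numerator_def power2_commute[of w z]
      u_def[symmetric] v_def[symmetric] Let_def
    by (simp add: field_simps power2_eq_square)
qed

text \<open>For \<open>p = 0\<close> a factor \<open>z\<close> cancels, which makes the formula valid at \<open>z = 0\<close> as well.\<close>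

definition hypergeo_numerator0 ::
  "complex \<Rightarrow> complex \<Rightarrow> complex \<Rightarrow> complex \<Rightarrow> complex \<Rightarrow> complex \<Rightarrow> complex \<Rightarrow> complex" where
  "hypergeo_numerator0 a b c q m w z =
     q * (q - 1) * z * (z - w)\<^sup>2 + m * (m - 1) * z * (1 - z)\<^sup>2 - 2 * q * m * z * (1 - z) * (z - w)
     + (c - (a + b + 1) * z) * (m * (1 - z) - q * (z - w)) * (z - w) - a * b * (1 - z) * (z - w)\<^sup>2"

lemma hypergeo_symbol_eq_numerator0:
  assumes "z \<noteq> 1" "z \<noteq> w"
  shows "hypergeo_symbol a b c 0 q m w z =
    hypergeo_numerator0 a b c q m w z / ((1 - z) * (w - z)\<^sup>2)"
proof -
  define u where "u = 1 - z"
  define v where "v = z - w"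
  have "u \<noteq> 0" "v \<noteq> 0" using assms by (auto simp: u_def v_def)
  then show ?thesis
    unfolding hypergeo_symbol_def hypergeo_numerator0_def power2_commute[of w z]
      u_def[symmetric] v_def[symmetric] Let_def
    by (simp add: field_simps power2_eq_square)
qed

text \<open>Serves the cases where \<open>R\<close> is a quotient: \<open>r\<close> stands for
  \<open>R\<close>, and \<open>u\<close> is the factor shared by \<open>h\<close> and
  \<open>g * r\<close>. Cancelling it leaves \<open>v\<close> and \<open>w\<close>, hence a
  polynomial identity without quotients or absolute values.\<close>

lemma cross_mult_ratio:
  fixes A B :: complex
  assumes "A * of_real v = B * of_real w" "h = v * u" "w * u = g * r"
  shows "A * of_real h = B * of_real g * of_real r"
  using assms by (metis mult.assoc of_real_mult)

text \<open>For \<open>y\<close> strictly between 0 and \<open>x\<close> the signs agree, which is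
  recorded as \<open>x * y > 0\<close> and later turns \<open>\<bar>y\<bar> / \<bar>x\<bar>\<close>
  into \<open>y / x\<close>.\<close>

lemma kernel_identity_punctured:
  assumes K: "\<And>x y. x < 1 \<Longrightarrow> x \<noteq> 0 \<Longrightarrow> y < 1 \<Longrightarrow> y \<noteq> 0 \<Longrightarrow> K x y =
      exp (p * of_real (ln \<bar>x\<bar>) + q * of_real (ln (1 - x)) + r * of_real (ln \<bar>y\<bar>) + s * of_real (ln (1 - y)))"
    and R: "\<And>x y. x < 1 \<Longrightarrow> x \<noteq> 0 \<Longrightarrow> y < 1 \<Longrightarrow> y \<noteq> 0 \<Longrightarrow> complex_of_real (R x y) =
      exp (d * (of_real (ln \<bar>y\<bar>) - of_real (ln \<bar>x\<bar>)) + e * (of_real (ln (1 - y)) - of_real (ln (1 - x))))"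
    and numerator: "\<And>x y. x < 1 \<Longrightarrow> y < 1 \<Longrightarrow> x * y > 0 \<Longrightarrow>
      hypergeo_numerator a' b' c' p q (\<mu> - 1) (of_real y) (of_real x) * of_real (y * (1 - y)) =
      hypergeo_numerator (1 - a) (1 - b) (2 - c) (r + d) (s + e) (\<mu> - 1) (of_real x) (of_real y)
        * of_real (x * (1 - x)) * of_real (R x y)"
  shows "kernel_identity a b c \<mu> (a', b', c') 0 K R ({..<0} \<union> {0<..<1})"
proof (rule kernel_identity_of_symbol)
  fix x y :: real
  assume x: "x \<in> {..<0} \<union> {0<..<1}" and "y \<in> ivl_between 0 x"
  then have y: "y < 1" "x * y > 0" "y \<noteq> x"
    by (auto simp: ivl_between_def min_def max_def zero_ereal_def zero_less_mult_iff split: if_splits)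
  then show "y \<in> {..<0} \<union> {0<..<1} \<and> y \<noteq> x"
    by (auto simp: zero_less_mult_iff)
  let ?X = "complex_of_real x" and ?Y = "complex_of_real y"
  have nz: "?X \<noteq> 0" "?Y \<noteq> 0" "?X \<noteq> 1" "?Y \<noteq> 1" "?X \<noteq> ?Y" "?Y \<noteq> ?X"
    using x y by auto
  then have nz': "1 - ?X \<noteq> 0" "1 - ?Y \<noteq> 0" "(?X - ?Y)\<^sup>2 \<noteq> 0"
    by auto
  show "hypergeo_symbol a' b' c' p q (\<mu> - 1) ?Y ?X =
      hypergeo_symbol (1 - a) (1 - b) (2 - c) (r + d) (s + e) (\<mu> - 1) ?X ?Y * of_real (R x y)"
    \<comment> \<open>Both denominators contain the same square \<open>(x - y)\<^sup>2\<close>,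
      which cancels; cross-multiplication by the remaining factors gives
      \<open>numerator\<close>.\<close>
    using numerator[of x y] x y nz nz'
    by (simp add: hypergeo_symbol_eq_numerator power2_commute[of ?X ?Y] frac_eq_eq) (auto simp: mult_ac)
qed (use K R in auto)

text \<open>The variant for intervals through 0: no powers of \<open>\<bar>x\<bar>\<close> or
  \<open>\<bar>y\<bar>\<close> occur, so the reduced numerators apply. The base point stays general
  because both \<open>-\<infinity>\<close> and 1 are used.\<close>

lemma kernel_identity_unpunctured:
  assumes x0: "\<And>x y. x < 1 \<Longrightarrow> y \<in> ivl_between x0 x \<Longrightarrow> y < 1 \<and> y \<noteq> x"
    and K: "\<And>x y. x < 1 \<Longrightarrow> y < 1 \<Longrightarrow> K x y = exp (q * of_real (ln (1 - x)) + s * of_real (ln (1 - y)))"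
    and R: "\<And>x y. x < 1 \<Longrightarrow> y < 1 \<Longrightarrow> complex_of_real (R x y) =
      exp (e * (of_real (ln (1 - y)) - of_real (ln (1 - x))))"
    and numerator: "\<And>x y. x < 1 \<Longrightarrow> y < 1 \<Longrightarrow>
      hypergeo_numerator0 a' b' c' q (\<mu> - 1) (of_real y) (of_real x) * of_real (1 - y) =
      hypergeo_numerator0 (1 - a) (1 - b) (2 - c) (s + e) (\<mu> - 1) (of_real x) (of_real y)
        * of_real (1 - x) * of_real (R x y)"
  shows "kernel_identity a b c \<mu> (a', b', c') x0 K R {..<1}"
proof (rule kernel_identity_of_symbol[where p = 0 and r = 0 and d = 0])
  fix x y :: real
  assume x: "x \<in> {..<1}" and "y \<in> ivl_between x0 x"
  then have y: "y < 1" "y \<noteq> x" using x0 by auto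
  then show "y \<in> {..<1} \<and> y \<noteq> x" by simp
  let ?X = "complex_of_real x" and ?Y = "complex_of_real y"
  have nz: "?X \<noteq> 1" "?Y \<noteq> 1" "?X \<noteq> ?Y" "?Y \<noteq> ?X"
    using x y by auto
  then have nz': "1 - ?X \<noteq> 0" "1 - ?Y \<noteq> 0" "(?X - ?Y)\<^sup>2 \<noteq> 0"
    by auto
  show "hypergeo_symbol a' b' c' 0 q (\<mu> - 1) ?Y ?X =
      hypergeo_symbol (1 - a) (1 - b) (2 - c) (0 + 0) (s + e) (\<mu> - 1) ?X ?Y * of_real (R x y)"
    using numerator[of x y] x y nz nz'
    by (simp add: hypergeo_symbol_eq_numerator0 power2_commute[of ?X ?Y] frac_eq_eq)
qed (use K R in auto)

section \<open>The eight kernels\<close>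

lemma kernel_identity_case1:
  "kernel_identity a b c \<mu> (a, b, c + \<mu>) 0
       (\<lambda>x y. of_real \<bar>y\<bar> powr (c - 1) / of_real \<bar>x\<bar> powr (c + \<mu> - 1))
       (\<lambda>x y. 1)
       ({..<0} \<union> {0<..<1})"
\<comment> \<open>The exponents are read off from \<open>K\<close>, with a minus sign for powers in
  its denominator; \<open>R = 1\<close> gives \<open>d = e = 0\<close>.\<close>
proof (rule kernel_identity_punctured[where p = "- (c + \<mu> - 1)" and q = "0"
      and r = "c - 1" and s = "0" and d = 0 and e = 0], goal_cases)
  case (1 x y)
  then show ?case
    by (simp add: of_real_powr_eq_exp_ln del: of_real_diff flip: exp_add exp_diff)
      (simp add: algebra_simps)
next
  case (2 x y)
  then show ?case
    by simp
next
  case (3 x y)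
  show ?case
    \<comment> \<open>What remains is a polynomial identity in the parameters and the images of
      \<open>x\<close> and \<open>y\<close>, settled by Groebner bases.\<close>
    unfolding hypergeo_numerator_def of_real_mult of_real_diff of_real_1 by algebra
qed

lemma kernel_identity_case2:
  "kernel_identity a b c \<mu> (a + \<mu>, b, c + \<mu>) 0
       (\<lambda>x y. (of_real \<bar>y\<bar> powr (c - 1) * of_real (1 - y) powr (b - c - \<mu>))
            / (of_real \<bar>x\<bar> powr (c + \<mu> - 1) * of_real (1 - x) powr (b - c)))
       (\<lambda>x y. (1 - y) / (1 - x))
       ({..<0} \<union> {0<..<1})"
proof (rule kernel_identity_punctured[where p = "- (c + \<mu> - 1)" and q = "- (b - c)"
      and r = "c - 1" and s = "b - c - \<mu>" and d = 0 and e = 1], goal_cases)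
  case (1 x y)
  then show ?case
    \<comment> \<open>\<open>of_real (1 - y)\<close> must not be split, so that it is still
      recognised as a power with positive real base.\<close>
    by (simp add: of_real_powr_eq_exp_ln del: of_real_diff flip: exp_add exp_diff)
      (simp add: algebra_simps)
next
  case (2 x y)
  then show ?case
    by (simp add: exp_diff exp_of_real del: of_real_diff of_real_minus)
next
  case (3 x y)
  show ?case
  \<comment> \<open>Since \<open>x * (1 - x) * R = x * (1 - y)\<close>, the factor
    \<open>1 - y\<close> is common to both sides.\<close>
  proof (rule cross_mult_ratio[where v = "y" and w = "x" and u = "1 - y"])
    from 3 show "x * (1 - y) = x * (1 - x) * ((1 - y) / (1 - x))"
      by (auto simp: abs_if zero_less_mult_iff)
  qed (unfold hypergeo_numerator_def of_real_diff of_real_1, algebra, simp add: mult.commute)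
qed

lemma kernel_identity_case3:
  "kernel_identity a b c \<mu> (a + \<mu>, b + \<mu>, c + \<mu>) 0
       (\<lambda>x y. (of_real \<bar>y\<bar> powr (c - 1) * of_real (1 - y) powr (a + b - c))
            / (of_real \<bar>x\<bar> powr (c + \<mu> - 1) * of_real (1 - x) powr (a + b - c + \<mu>)))
       (\<lambda>x y. 1)
       ({..<0} \<union> {0<..<1})"
proof (rule kernel_identity_punctured[where p = "- (c + \<mu> - 1)" and q = "- (a + b - c + \<mu>)"
      and r = "c - 1" and s = "a + b - c" and d = 0 and e = 0], goal_cases)
  case (1 x y)
  then show ?case
    by (simp add: of_real_powr_eq_exp_ln del: of_real_diff flip: exp_add exp_diff)
      (simp add: algebra_simps)
next
  case (2 x y)
  then show ?case
    by simp
next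
  case (3 x y)
  show ?case
    unfolding hypergeo_numerator_def of_real_mult of_real_diff of_real_1 by algebra
qed

lemma kernel_identity_case4:
  "kernel_identity a b c \<mu> (a - \<mu>, b, c) 0
       (\<lambda>x y. of_real \<bar>y\<bar> powr (a - \<mu> - 1) / of_real \<bar>x\<bar> powr (a - 1))
       (\<lambda>x y. \<bar>y\<bar> / \<bar>x\<bar>)
       ({..<0} \<union> {0<..<1})"
proof (rule kernel_identity_punctured[where p = "- (a - 1)" and q = "0"
      and r = "a - \<mu> - 1" and s = "0" and d = 1 and e = 0], goal_cases)
  case (1 x y)
  then show ?case
    by (simp add: of_real_powr_eq_exp_ln del: of_real_diff flip: exp_add exp_diff)
      (simp add: algebra_simps)
next
  case (2 x y)
  then show ?case
    by (simp add: exp_diff exp_of_real del: of_real_diff of_real_minus)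
next
  case (3 x y)
  show ?case
  \<comment> \<open>Equal signs give \<open>R = y / x\<close>, so
    \<open>x * (1 - x) * R = (1 - x) * y\<close> and the common factor is \<open>y\<close>.\<close>
  proof (rule cross_mult_ratio[where v = "1 - y" and w = "1 - x" and u = "y"])
    from 3 show "(1 - x) * y = x * (1 - x) * (\<bar>y\<bar> / \<bar>x\<bar>)"
      by (auto simp: abs_if zero_less_mult_iff)
  qed (unfold hypergeo_numerator_def of_real_diff of_real_1, algebra, simp add: mult.commute)
qed

lemma kernel_identity_case5:
  "kernel_identity a b c \<mu> (a + \<mu>, b, c) 0
       (\<lambda>x y. (of_real \<bar>y\<bar> powr (c - a - \<mu> - 1) * of_real (1 - y) powr (a + b - c))
            / (of_real \<bar>x\<bar> powr (c - a - 1) * of_real (1 - x) powr (a + b - c + \<mu>)))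
       (\<lambda>x y. \<bar>y\<bar> / \<bar>x\<bar>)
       ({..<0} \<union> {0<..<1})"
proof (rule kernel_identity_punctured[where p = "- (c - a - 1)" and q = "- (a + b - c + \<mu>)"
      and r = "c - a - \<mu> - 1" and s = "a + b - c" and d = 1 and e = 0], goal_cases)
  case (1 x y)
  then show ?case
    by (simp add: of_real_powr_eq_exp_ln del: of_real_diff flip: exp_add exp_diff)
      (simp add: algebra_simps)
next
  case (2 x y)
  then show ?case
    by (simp add: exp_diff exp_of_real del: of_real_diff of_real_minus)
next
  case (3 x y)
  show ?case
  proof (rule cross_mult_ratio[where v = "1 - y" and w = "1 - x" and u = "y"])
    from 3 show "(1 - x) * y = x * (1 - x) * (\<bar>y\<bar> / \<bar>x\<bar>)"
      by (auto simp: abs_if zero_less_mult_iff)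
  qed (unfold hypergeo_numerator_def of_real_diff of_real_1, algebra, simp add: mult.commute)
qed

lemma kernel_identity_case6:
  "kernel_identity a b c \<mu> (a - \<mu>, b - \<mu>, c - \<mu>) (-\<infinity>)
       (\<lambda>x y. 1)
       (\<lambda>x y. 1)
       {..<1}"
proof (rule kernel_identity_unpunctured[where q = "0" and s = "0" and e = 0], goal_cases)
  case (1 x y)
  then show ?case
    by (auto simp: ivl_between_def min_def max_def one_ereal_def split: if_splits)
next
  case (2 x y)
  then show ?case
    by simp
next
  case (3 x y)
  then show ?case
    by simp
next
  case (4 x y)
  show ?case
    unfolding hypergeo_numerator0_def of_real_mult of_real_diff of_real_1 by algebra
qed

lemma kernel_identity_case7:
  "kernel_identity a b c \<mu> (a - \<mu>, b, c - \<mu>) 1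
       (\<lambda>x y. of_real (1 - y) powr (a - \<mu> - 1) / of_real (1 - x) powr (a - 1))
       (\<lambda>x y. (1 - y) / (1 - x))
       {..<1}"
proof (rule kernel_identity_unpunctured[where q = "- (a - 1)" and s = "a - \<mu> - 1" and e = 1], goal_cases)
  case (1 x y)
  then show ?case
    \<comment> \<open>The base point 1 lies to the right of \<open>x\<close>, so here
      \<open>x < y < 1\<close>.\<close>
    by (auto simp: ivl_between_def min_def max_def one_ereal_def split: if_splits)
next
  case (2 x y)
  then show ?case
    by (simp add: of_real_powr_eq_exp_ln del: of_real_diff flip: exp_add exp_diff)
      (simp add: algebra_simps)
next
  case (3 x y)
  then show ?case
    by (simp add: exp_diff exp_of_real del: of_real_diff of_real_minus)
next
  case (4 x y)
  show ?case
  \<comment> \<open>Here \<open>(1 - x) * R = 1 - y\<close> cancels completely, so the two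
    numerators themselves are equal.\<close>
  proof (rule cross_mult_ratio[where v = "1" and w = "1" and u = "1 - y"])
    from 4 show "1 * (1 - y) = (1 - x) * ((1 - y) / (1 - x))"
      by (auto simp: abs_if zero_less_mult_iff)
  qed (unfold hypergeo_numerator0_def of_real_diff of_real_1, algebra, simp add: mult.commute)
qed

lemma kernel_identity_case8:
  "kernel_identity a b c \<mu> (a, b, c - \<mu>) (-\<infinity>)
       (\<lambda>x y. of_real (1 - y) powr (a + b - c) / of_real (1 - x) powr (a + b - c + \<mu>))
       (\<lambda>x y. 1)
       {..<1}"
proof (rule kernel_identity_unpunctured[where q = "- (a + b - c + \<mu>)" and s = "a + b - c" and e = 0], goal_cases)
  case (1 x y)
  then show ?case
    by (auto simp: ivl_between_def min_def max_def one_ereal_def split: if_splits)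
next
  case (2 x y)
  then show ?case
    by (simp add: of_real_powr_eq_exp_ln del: of_real_diff flip: exp_add exp_diff)
      (simp add: algebra_simps)
next
  case (3 x y)
  then show ?case
    by simp
next
  case (4 x y)
  show ?case
    unfolding hypergeo_numerator0_def of_real_mult of_real_diff of_real_1 by algebra
qed

theorem mainTheorem6:
  fixes a b c \<mu> :: complex
  shows
    "kernel_identity a b c \<mu> (a, b, c + \<mu>) 0
       (\<lambda>x y. of_real \<bar>y\<bar> powr (c - 1) / of_real \<bar>x\<bar> powr (c + \<mu> - 1))
       (\<lambda>x y. 1)
       ({..<0} \<union> {0<..<1})
   \<and> kernel_identity a b c \<mu> (a + \<mu>, b, c + \<mu>) 0
       (\<lambda>x y. (of_real \<bar>y\<bar> powr (c - 1) * of_real (1 - y) powr (b - c - \<mu>))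
            / (of_real \<bar>x\<bar> powr (c + \<mu> - 1) * of_real (1 - x) powr (b - c)))
       (\<lambda>x y. (1 - y) / (1 - x))
       ({..<0} \<union> {0<..<1})
   \<and> kernel_identity a b c \<mu> (a + \<mu>, b + \<mu>, c + \<mu>) 0
       (\<lambda>x y. (of_real \<bar>y\<bar> powr (c - 1) * of_real (1 - y) powr (a + b - c))
            / (of_real \<bar>x\<bar> powr (c + \<mu> - 1) * of_real (1 - x) powr (a + b - c + \<mu>)))
       (\<lambda>x y. 1)
       ({..<0} \<union> {0<..<1})
   \<and> kernel_identity a b c \<mu> (a - \<mu>, b, c) 0
       (\<lambda>x y. of_real \<bar>y\<bar> powr (a - \<mu> - 1) / of_real \<bar>x\<bar> powr (a - 1))
       (\<lambda>x y. \<bar>y\<bar> / \<bar>x\<bar>)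
       ({..<0} \<union> {0<..<1})
   \<and> kernel_identity a b c \<mu> (a + \<mu>, b, c) 0
       (\<lambda>x y. (of_real \<bar>y\<bar> powr (c - a - \<mu> - 1) * of_real (1 - y) powr (a + b - c))
            / (of_real \<bar>x\<bar> powr (c - a - 1) * of_real (1 - x) powr (a + b - c + \<mu>)))
       (\<lambda>x y. \<bar>y\<bar> / \<bar>x\<bar>)
       ({..<0} \<union> {0<..<1})
   \<and> kernel_identity a b c \<mu> (a - \<mu>, b - \<mu>, c - \<mu>) (-\<infinity>)
       (\<lambda>x y. 1)
       (\<lambda>x y. 1)
       {..<1}
   \<and> kernel_identity a b c \<mu> (a - \<mu>, b, c - \<mu>) 1
       (\<lambda>x y. of_real (1 - y) powr (a - \<mu> - 1) / of_real (1 - x) powr (a - 1))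
       (\<lambda>x y. (1 - y) / (1 - x))
       {..<1}
   \<and> kernel_identity a b c \<mu> (a, b, c - \<mu>) (-\<infinity>)
       (\<lambda>x y. of_real (1 - y) powr (a + b - c) / of_real (1 - x) powr (a + b - c + \<mu>))
       (\<lambda>x y. 1)
       {..<1}"
  by (intro conjI kernel_identity_case1 kernel_identity_case2 kernel_identity_case3 kernel_identity_case4 kernel_identity_case5 kernel_identity_case6 kernel_identity_case7 kernel_identity_case8)

end
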